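(* Let $N\ge 2$ and let $\rho_N'$ be the $N$-qubit cat state after the independent Pauli channel with probabilities $\pi_0,\pi_1,\pi_2,\pi_3$ has acted on every qubit. Let $a=\pi_0+\pi_3$, $b=\pi_1+\pi_2$, $c=\pi_0-\pi_3$, $d=\pi_1-\pi_2$, $\Delta=|c^N+d^N|$ and $2\lambda_{k,N-k}=a^kb^{N-k}+b^ka^{N-k}$. If there is at least one integer $k$ with $1\le k\le \lfloor N/2\rfloor$ such that $$\Delta>2\lambda_{k,N-k},$$ then the state $\rho_N'$ is entangled.
   Context: Setting: $\pi_0,\pi_1,\pi_2,\pi_3\ge 0$ with $\sum_{i=0}^3\pi_i=1$. The single-qubit channel is $S(\rho)=\pi_0\rho+\sum_{i=1}^3\pi_i\sigma_i\rho\sigma_i$, where $\sigma_1,\sigma_2,\sigma_3$ are the Pauli matrices $\sigma_x,\sigma_y,\sigma_z$. The $N$-qubit cat (GHZ) state is $|\Psi\rangle_N=\frac{1}{\sqrt2}(|0\rangle^{\otimes N}+|1\rangle^{\otimes N})$, and $\rho_N'=S^{\otimes N}(|\Psi\rangle_N\langle\Psi|)$. An $N$-qubit state is entangled if it is not fully separable, i.e. not a convex combination of product states of the $N$ qubits. *)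

theory Defs
  imports "HOL-Analysis.Analysis"
begin

text \<open>
  The qubits are the elements of a finite type \<open>'n\<close>, so that there are \<open>CARD('n)\<close> of them. The
  computational basis of one qubit is indexed by the two elements \<open>0\<close> and \<open>1\<close> of the numeral
  type \<open>2\<close>, and that of the whole register by the bit strings \<open>'n \<Rightarrow> 2\<close>.
\<close>

type_synonym qubit_op = "complex^2^2"
type_synonym 'n qubits_vec = "complex^('n \<Rightarrow> 2)"
type_synonym 'n qubits_op = "complex^('n \<Rightarrow> 2)^('n \<Rightarrow> 2)"

definition ket :: "'a::finite \<Rightarrow> complex^'a" where
  "ket i = axis i 1"

text \<open>\<open>outer v w\<close> is $|v\rangle\langle w|$.\<close>

definition outer :: "complex^'a::finite \<Rightarrow> complex^'b::finite \<Rightarrow> complex^'b^'a" where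
  "outer v w = (\<chi> i j. v $ i * cnj (w $ j))"

definition tensor_vec :: "('n::finite \<Rightarrow> complex^2) \<Rightarrow> 'n qubits_vec" where
  "tensor_vec v = (\<chi> s. \<Prod>i\<in>UNIV. v i $ s i)"

definition tensor_op :: "('n::finite \<Rightarrow> qubit_op) \<Rightarrow> 'n qubits_op" where
  "tensor_op A = (\<chi> s t. \<Prod>i\<in>UNIV. A i $ s i $ t i)"

text \<open>
  The tensor power of a linear map \<open>T\<close> on single-qubit operators: it sends the matrix unit
  $|s\rangle\langle t| = \bigotimes_i |s_i\rangle\langle t_i|$ to
  $\bigotimes_i T(|s_i\rangle\langle t_i|)$ and is extended linearly. The lemma
  \<open>channel_power_tensor_op\<close> below shows that it acts as expected on all product operators.
\<close>

definition channel_power :: "(qubit_op \<Rightarrow> qubit_op) \<Rightarrow> 'n::finite qubits_op \<Rightarrow> 'n qubits_op" where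
  "channel_power T \<rho> = (\<chi> u v. \<Sum>s\<in>UNIV. \<Sum>t\<in>UNIV.
     \<rho> $ s $ t * tensor_op (\<lambda>i. T (outer (ket (s i)) (ket (t i)))) $ u $ v)"

definition sigma_x :: qubit_op where
  "sigma_x = outer (ket 0) (ket 1) + outer (ket 1) (ket 0)"

definition sigma_y :: qubit_op where
  "sigma_y = (\<chi> i j. - \<i> * outer (ket 0) (ket 1) $ i $ j + \<i> * outer (ket 1) (ket 0) $ i $ j)"

definition sigma_z :: qubit_op where
  "sigma_z = outer (ket 0) (ket 0) - outer (ket 1) (ket 1)"

definition pauli_channel :: "real \<Rightarrow> real \<Rightarrow> real \<Rightarrow> real \<Rightarrow> qubit_op \<Rightarrow> qubit_op" where
  "pauli_channel \<pi>\<^sub>0 \<pi>\<^sub>1 \<pi>\<^sub>2 \<pi>\<^sub>3 \<rho> =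
     \<pi>\<^sub>0 *\<^sub>R \<rho>
   + \<pi>\<^sub>1 *\<^sub>R (sigma_x ** \<rho> ** sigma_x)
   + \<pi>\<^sub>2 *\<^sub>R (sigma_y ** \<rho> ** sigma_y)
   + \<pi>\<^sub>3 *\<^sub>R (sigma_z ** \<rho> ** sigma_z)"

definition cat_vec :: "'n::finite qubits_vec" where
  "cat_vec = (1 / sqrt 2) *\<^sub>R (tensor_vec (\<lambda>_. ket 0) + tensor_vec (\<lambda>_. ket 1))"

definition noisy_cat_state :: "real \<Rightarrow> real \<Rightarrow> real \<Rightarrow> real \<Rightarrow> 'n::finite qubits_op" where
  "noisy_cat_state \<pi>\<^sub>0 \<pi>\<^sub>1 \<pi>\<^sub>2 \<pi>\<^sub>3 =
     channel_power (pauli_channel \<pi>\<^sub>0 \<pi>\<^sub>1 \<pi>\<^sub>2 \<pi>\<^sub>3) (outer cat_vec cat_vec)"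

text \<open>
  Over the complex numbers, $\langle v|A|v\rangle \ge 0$ for all $v$ already forces \<open>A\<close> to be
  Hermitian.
\<close>

definition positive_op :: "complex^'a::finite^'a \<Rightarrow> bool" where
  "positive_op A \<longleftrightarrow> (\<forall>v. (\<Sum>i\<in>UNIV. cnj (v $ i) * (A *v v) $ i) \<in> \<real>\<^sub>\<ge>\<^sub>0)"

definition density_op :: "complex^'a::finite^'a \<Rightarrow> bool" where
  "density_op \<rho> \<longleftrightarrow> positive_op \<rho> \<and> trace \<rho> = 1"

definition product_states :: "'n::finite qubits_op set" where
  "product_states = {tensor_op \<rho> | \<rho>. \<forall>i. density_op (\<rho> i)}"

definition fully_separable :: "'n::finite qubits_op \<Rightarrow> bool" where
  "fully_separable \<rho> \<longleftrightarrow> \<rho> \<in> convex hull product_states"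

definition entangled :: "'n::finite qubits_op \<Rightarrow> bool" where
  "entangled \<rho> \<longleftrightarrow> density_op \<rho> \<and> \<not> fully_separable \<rho>"

lemma prod_sum_UNIV:
  fixes f :: "'n::finite \<Rightarrow> 'b::finite \<Rightarrow> complex"
  shows "(\<Prod>i\<in>UNIV. \<Sum>b\<in>UNIV. f i b) = (\<Sum>s\<in>UNIV. \<Prod>i\<in>UNIV. f i (s i))"
  using prod_sum_PiE[of "UNIV :: 'n set" "\<lambda>_. UNIV :: 'b set" f] by (simp add: PiE_UNIV_domain)

lemma channel_power_tensor_op:
  assumes add: "\<And>A B. T (A + B) = T A + T B"
    and scale: "\<And>c A. T (\<chi> i j. c * A $ i $ j) = (\<chi> i j. c * T A $ i $ j)"
  shows "channel_power T (tensor_op A) = tensor_op (\<lambda>i. T (A i))"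
proof -
  let ?E = "\<lambda>a b. outer (ket a) (ket b) :: qubit_op"
  have zero: "T 0 = 0"
    using add[of 0 0] by simp
  have sum: "T (\<Sum>x\<in>X. F x) = (\<Sum>x\<in>X. T (F x))" if "finite X" for X :: "2 set" and F
    using that by induction (simp_all add: zero add)
  have expand: "B = (\<Sum>a\<in>UNIV. \<Sum>b\<in>UNIV. \<chi> i j. B $ a $ b * ?E a b $ i $ j)" for B :: qubit_op
  proof -
    have "?E a b $ i $ j = (if a = i then if b = j then 1 else 0 else 0)" for a b i j
      by (auto simp: outer_def ket_def axis_def)
    then have "B $ a $ b * ?E a b $ i $ j = (if a = i then if b = j then B $ a $ b else 0 else 0)"
      for a b i j
      by simp
    then have "(\<Sum>a\<in>UNIV. \<Sum>b\<in>UNIV. B $ a $ b * ?E a b $ i $ j) =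
        (\<Sum>a\<in>UNIV. if a = i then \<Sum>b\<in>UNIV. if b = j then B $ a $ b else 0 else 0)" for i j
      by (intro sum.cong) auto
    then show ?thesis
      by (simp add: vec_eq_iff)
  qed
  have T_entry: "T B $ u $ v = (\<Sum>a\<in>UNIV. \<Sum>b\<in>UNIV. B $ a $ b * T (?E a b) $ u $ v)" for B u v
  proof -
    have "T B = (\<Sum>a\<in>UNIV. \<Sum>b\<in>UNIV. \<chi> i j. B $ a $ b * T (?E a b) $ i $ j)"
      by (subst expand[of B]) (simp only: sum[OF finite] scale)
    then show ?thesis
      by simp
  qed
  have "(\<Prod>i\<in>UNIV. T (A i) $ u i $ v i) =
      (\<Sum>s\<in>UNIV. \<Sum>t\<in>UNIV. (\<Prod>i\<in>UNIV. A i $ s i $ t i) * (\<Prod>i\<in>UNIV. T (?E (s i) (t i)) $ u i $ v i))"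
    for u v
  proof -
    have "(\<Prod>i\<in>UNIV. T (A i) $ u i $ v i) =
        (\<Prod>i\<in>UNIV. \<Sum>a\<in>UNIV. \<Sum>b\<in>UNIV. A i $ a $ b * T (?E a b) $ u i $ v i)"
      by (intro prod.cong refl T_entry)
    then show ?thesis
      by (simp only: prod_sum_UNIV prod.distrib)
  qed
  then show ?thesis
    by (simp add: channel_power_def tensor_op_def vec_eq_iff)
qed

lemma channel_power_pauli_channel:
  "channel_power (pauli_channel \<pi>\<^sub>0 \<pi>\<^sub>1 \<pi>\<^sub>2 \<pi>\<^sub>3) (tensor_op A) =
   tensor_op (\<lambda>i. pauli_channel \<pi>\<^sub>0 \<pi>\<^sub>1 \<pi>\<^sub>2 \<pi>\<^sub>3 (A i))"
proof (rule channel_power_tensor_op)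
  fix A B :: qubit_op
  have conj: "P ** (A + B) ** P = P ** A ** P + P ** B ** P" for P :: qubit_op
    by (simp add: matrix_matrix_mult_def vec_eq_iff sum.distrib distrib_left distrib_right)
  show "pauli_channel \<pi>\<^sub>0 \<pi>\<^sub>1 \<pi>\<^sub>2 \<pi>\<^sub>3 (A + B) =
      pauli_channel \<pi>\<^sub>0 \<pi>\<^sub>1 \<pi>\<^sub>2 \<pi>\<^sub>3 A + pauli_channel \<pi>\<^sub>0 \<pi>\<^sub>1 \<pi>\<^sub>2 \<pi>\<^sub>3 B"
    unfolding pauli_channel_def conj by (simp add: scaleR_add_right)
next
  fix c :: complex and A :: qubit_op
  have conj: "P ** (\<chi> i j. c * A $ i $ j) ** P = (\<chi> i j. c * (P ** A ** P) $ i $ j)" for P :: qubit_op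
    by (simp add: matrix_matrix_mult_def vec_eq_iff sum_distrib_left sum_distrib_right mult_ac)
  show "pauli_channel \<pi>\<^sub>0 \<pi>\<^sub>1 \<pi>\<^sub>2 \<pi>\<^sub>3 (\<chi> i j. c * A $ i $ j) =
      (\<chi> i j. c * pauli_channel \<pi>\<^sub>0 \<pi>\<^sub>1 \<pi>\<^sub>2 \<pi>\<^sub>3 A $ i $ j)"
    unfolding pauli_channel_def conj by (simp add: vec_eq_iff distrib_left)
qed

end

theory Submission
  imports Defs
begin

text \<open>
  For a product state, \<open>\<bar>\<rho> $ s $ t\<bar>\<close> is at most the product of the square roots
  \<open>\<surd>(\<rho>\<^sub>i $ s i $ s i * \<rho>\<^sub>i $ t i $ t i)\<close>. These factors can be redistributed between any two strings
  \<open>w\<close>, \<open>w'\<close> which arise from \<open>s\<close>, \<open>t\<close> by exchanging bits at some positions, so that by AM-GM the mean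
  of the diagonal entries at \<open>w\<close> and \<open>w'\<close> is an upper bound. The bound is convex in \<open>\<rho>\<close>, hence holds
  for all fully separable states. The noisy cat state has nonzero entries only on the diagonal and
  the antidiagonal; its corner entry has modulus \<open>\<Delta> / 2\<close> and its diagonal entries at a string
  with \<open>k\<close> zeros and at the complementary string are both \<open>\<lambda>\<close>$_{k,N-k}$, so that the hypothesis
  violates the bound.
\<close>

section \<open>Minors of positive operators\<close>

text \<open>The quadratic form is evaluated at a vector supported on the two indices
  \<open>s\<close> and \<open>t\<close>, which reduces the minor inequality to a two-dimensional
  computation.\<close>

lemma positive_op_pair:
  fixes A :: "complex^'a::finite^'a"
  assumes "positive_op A" and "s \<noteq> t"
  shows "cnj x * x * A $ s $ s + cnj x * y * A $ s $ t + cnj y * x * A $ t $ s + cnj y * y * A $ t $ t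
    \<in> \<real>\<^sub>\<ge>\<^sub>0"
proof -
  define v where "v = (\<chi> i. if i = s then x else if i = t then y else 0)"
  have restrict: "(\<Sum>i\<in>UNIV. f i) = f s + f t" if "\<And>i. i \<noteq> s \<Longrightarrow> i \<noteq> t \<Longrightarrow> f i = 0" for f :: "'a \<Rightarrow> complex"
  proof -
    have "(\<Sum>i\<in>UNIV. f i) = (\<Sum>i\<in>{s, t}. f i)"
      by (rule sum.mono_neutral_right) (use that in auto)
    then show ?thesis
      using \<open>s \<noteq> t\<close> by simp
  qed
  have mult: "(A *v v) $ i = A $ i $ s * x + A $ i $ t * y" for i
    unfolding matrix_vector_mult_def using \<open>s \<noteq> t\<close>
    by (simp add: restrict v_def)
  have "(\<Sum>i\<in>UNIV. cnj (v $ i) * (A *v v) $ i) = cnj x * (A *v v) $ s + cnj y * (A *v v) $ t"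
    using \<open>s \<noteq> t\<close> by (subst restrict) (simp_all add: v_def)
  also have "\<dots> = cnj x * x * A $ s $ s + cnj x * y * A $ s $ t + cnj y * x * A $ t $ s + cnj y * y * A $ t $ t"
    by (simp add: mult algebra_simps)
  finally show ?thesis
    using assms(1) unfolding positive_op_def by metis
qed

lemma positive_op_diag:
  fixes A :: "complex^'a::finite^'a"
  assumes "positive_op A"
  shows "A $ s $ s \<in> \<real>\<^sub>\<ge>\<^sub>0"
proof -
  have "(A *v ket s) $ s = (\<Sum>j\<in>UNIV. if j = s then A $ s $ j else 0)"
    unfolding matrix_vector_mult_def vec_lambda_beta
    by (rule sum.cong) (simp_all add: ket_def axis_def)
  then have "(A *v ket s) $ s = A $ s $ s"
    by simp
  moreover have "(\<Sum>i\<in>UNIV. cnj (ket s $ i) * (A *v ket s) $ i) =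
      (\<Sum>i\<in>UNIV. if i = s then (A *v ket s) $ i else 0)"
    by (intro sum.cong) (auto simp: ket_def axis_def)
  ultimately have "(\<Sum>i\<in>UNIV. cnj (ket s $ i) * (A *v ket s) $ i) = A $ s $ s"
    by simp
  then show ?thesis
    using assms unfolding positive_op_def by metis
qed

lemma positive_op_minor:
  fixes A :: "complex^'a::finite^'a"
  assumes pos: "positive_op A"
  shows "(cmod (A $ s $ t))\<^sup>2 \<le> Re (A $ s $ s) * Re (A $ t $ t)"
proof (cases "s = t")
  case True
  then show ?thesis
    using positive_op_diag[OF pos, of t] by (simp add: complex_nonneg_Reals_iff cmod_power2 flip: power2_eq_square)
next
  case False
  define \<alpha> \<beta> z where "\<alpha> = Re (A $ s $ s)" and "\<beta> = Re (A $ t $ t)" and "z = A $ s $ t"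
  note pair = positive_op_pair[OF pos False, unfolded complex_nonneg_Reals_iff]
  have ss: "A $ s $ s = of_real \<alpha>" and tt: "A $ t $ t = of_real \<beta>" and nonneg: "\<alpha> \<ge> 0" "\<beta> \<ge> 0"
    using positive_op_diag[OF pos, of s] positive_op_diag[OF pos, of t]
    by (auto simp: complex_nonneg_Reals_iff \<alpha>_def \<beta>_def complex_eq_iff)
  \<comment> \<open>Hermiticity comes from the form being real at (1, 1) and at (1, i): the first
    fixes the imaginary part of the entry, the second its real part.\<close>
  have ts: "A $ t $ s = cnj z"
    using pair[of 1 1] pair[of 1 \<i>] by (auto simp: ss tt z_def complex_eq_iff)
  \<comment> \<open>Aligning the phase of the test vector with \<open>z\<close> turns both cross
    terms into real multiples of the squared modulus, leaving a real quadratic form in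
    \<open>n\<close> and \<open>m\<close>.\<close>
  have quad: "n\<^sup>2 * (cmod z)\<^sup>2 * \<alpha> - 2 * n * m * (cmod z)\<^sup>2 + m\<^sup>2 * \<beta> \<ge> 0" for n m :: real
    using pair[of "- (of_real n * z)" "of_real m"]
    unfolding ss tt ts z_def[symmetric] cmod_power2
    by (simp add: power2_eq_square algebra_simps)
  have "(cmod z)\<^sup>2 \<le> \<alpha> * \<beta>"
  proof (rule ccontr)
    assume less: "\<not> ?thesis"
    then have z: "(cmod z)\<^sup>2 > 0"
      using mult_nonneg_nonneg[OF nonneg] by linarith
    show False
    proof (cases "\<beta> = 0")
      case True
      \<comment> \<open>With \<beta> = 0 the form is linear in \<open>m\<close>, so a large
        \<open>m\<close>, here \<alpha> + 1, makes it negative.\<close>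
      have "(cmod z)\<^sup>2 * (- \<alpha> - 2) \<ge> 0"
        using quad[of 1 "\<alpha> + 1"] True by (simp add: algebra_simps)
      then show False
        using z nonneg by (simp add: zero_le_mult_iff)
    next
      case False
      \<comment> \<open>For \<beta> > 0 and fixed \<open>n\<close>, the form is minimal at
        \<open>m\<close> = \<open>n\<close> |z|^2 / \<beta>; the choice \<open>n\<close> = \<beta>
        clears the denominator.\<close>
      have "(\<beta> * (cmod z)\<^sup>2) * (\<alpha> * \<beta> - (cmod z)\<^sup>2) \<ge> 0"
        using quad[of \<beta> "(cmod z)\<^sup>2"] by (simp add: power2_eq_square algebra_simps)
      moreover have "\<beta> * (cmod z)\<^sup>2 > 0"
        using z nonneg False by simp
      ultimately show False
        using less by (simp add: zero_le_mult_iff)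
    qed
  qed
  then show ?thesis
    by (simp add: \<alpha>_def \<beta>_def z_def)
qed

section \<open>A bound for fully separable states\<close>

text \<open>The minor bound at a site depends only on the unordered pair of bits \<open>s i\<close>,
  \<open>t i\<close>, so bits may be exchanged independently at each site. The estimate is done for
  squares, which avoids roots.\<close>

lemma tensor_op_entry_bound:
  fixes \<rho> :: "'n::finite \<Rightarrow> qubit_op"
  assumes pos: "\<And>i. positive_op (\<rho> i)"
    and w: "\<And>i. (w i = s i \<and> w' i = t i) \<or> (w i = t i \<and> w' i = s i)"
  shows "cmod (tensor_op \<rho> $ s $ t) \<le> (Re (tensor_op \<rho> $ w $ w) + Re (tensor_op \<rho> $ w' $ w')) / 2"
proof -
  have diag: "\<rho> i $ x $ x = of_real (Re (\<rho> i $ x $ x))" "Re (\<rho> i $ x $ x) \<ge> 0" for i x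
    using positive_op_diag[OF pos, of i x] by (auto simp: complex_nonneg_Reals_iff complex_eq_iff)
  define p where "p u = (\<Prod>i\<in>UNIV. Re (\<rho> i $ u i $ u i))" for u :: "'n \<Rightarrow> 2"
  have p: "Re (tensor_op \<rho> $ u $ u) = p u" for u
  proof -
    have "tensor_op \<rho> $ u $ u = (\<Prod>i\<in>UNIV. of_real (Re (\<rho> i $ u i $ u i)))"
      unfolding tensor_op_def by (simp flip: diag(1))
    then show ?thesis
      by (simp add: p_def flip: of_real_prod)
  qed
  have p_nonneg: "p u \<ge> 0" for u
    unfolding p_def by (simp add: prod_nonneg diag(2))
  have "(cmod (tensor_op \<rho> $ s $ t))\<^sup>2 = (\<Prod>i\<in>UNIV. (cmod (\<rho> i $ s i $ t i))\<^sup>2)"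
    by (simp add: tensor_op_def prod_power_distrib flip: prod_norm)
  also have "\<dots> \<le> (\<Prod>i\<in>UNIV. Re (\<rho> i $ s i $ s i) * Re (\<rho> i $ t i $ t i))"
    by (intro prod_mono) (simp add: positive_op_minor pos)
  also have "\<dots> = (\<Prod>i\<in>UNIV. Re (\<rho> i $ w i $ w i) * Re (\<rho> i $ w' i $ w' i))"
  proof (rule prod.cong[OF refl])
    show "Re (\<rho> i $ s i $ s i) * Re (\<rho> i $ t i $ t i) = Re (\<rho> i $ w i $ w i) * Re (\<rho> i $ w' i $ w' i)" for i
      using w[of i] by auto
  qed
  also have "\<dots> = p w * p w'"
    by (simp add: p_def prod.distrib)
  also have "\<dots> \<le> ((p w + p w') / 2)\<^sup>2"
    using zero_le_power2[of "p w - p w'"] by (simp add: power2_eq_square field_simps)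
  finally have "cmod (tensor_op \<rho> $ s $ t) \<le> (p w + p w') / 2"
    by (rule power2_le_imp_le) (simp add: p_nonneg)
  then show ?thesis
    by (simp add: p)
qed

text \<open>The left side is a seminorm in the operator and the right side is real-linear, so the
  operators obeying the bound form a convex set; containing the product states, it contains their
  hull.\<close>

lemma fully_separable_entry_bound:
  fixes \<rho> :: "'n::finite qubits_op"
  assumes sep: "fully_separable \<rho>"
    and w: "\<And>i. (w i = s i \<and> w' i = t i) \<or> (w i = t i \<and> w' i = s i)"
  shows "cmod (\<rho> $ s $ t) \<le> (Re (\<rho> $ w $ w) + Re (\<rho> $ w' $ w')) / 2"
proof -
  let ?B = "{\<rho> :: 'n qubits_op. cmod (\<rho> $ s $ t) \<le> (Re (\<rho> $ w $ w) + Re (\<rho> $ w' $ w')) / 2}"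
  have "convex ?B"
  proof (rule convexI, clarsimp)
    fix x y :: "'n qubits_op" and u v :: real
    assume x: "cmod (x $ s $ t) * 2 \<le> Re (x $ w $ w) + Re (x $ w' $ w')"
      and y: "cmod (y $ s $ t) * 2 \<le> Re (y $ w $ w) + Re (y $ w' $ w')"
      and u: "0 \<le> u" and v: "0 \<le> v"
    have "cmod (u *\<^sub>R x $ s $ t + v *\<^sub>R y $ s $ t) \<le> u * cmod (x $ s $ t) + v * cmod (y $ s $ t)"
      using norm_triangle_ineq[of "u *\<^sub>R x $ s $ t" "v *\<^sub>R y $ s $ t"] u v by simp
    then show "cmod (u *\<^sub>R x $ s $ t + v *\<^sub>R y $ s $ t) * 2
        \<le> u * Re (x $ w $ w) + v * Re (y $ w $ w) + (u * Re (x $ w' $ w') + v * Re (y $ w' $ w'))"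
      using mult_left_mono[OF x u] mult_left_mono[OF y v] by (simp add: algebra_simps)
  qed
  moreover have "product_states \<subseteq> ?B"
    using tensor_op_entry_bound[of _ w s w' t] w by (auto simp: product_states_def density_op_def)
  ultimately have "convex hull product_states \<subseteq> ?B"
    by (rule hull_minimal[rotated])
  then show ?thesis
    using sep by (auto simp: fully_separable_def)
qed

section \<open>Entries of the noisy cat state\<close>

lemma UNIV_bit: "(UNIV :: 2 set) = {0, 1}"
proof -
  have "x = 0 \<or> x = 1" for x :: 2
    using exhaust_2[of x] by auto
  then show ?thesis
    by auto
qed

lemma bit_cases: "x = 0 \<or> x = 1" for x :: 2
  using UNIV_bit by auto

lemma sum_bit: "(\<Sum>x\<in>(UNIV :: 2 set). f x) = f 0 + f 1"
  by (simp add: UNIV_bit)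

text \<open>The identity and \<open>sigma_z\<close> fix a matrix unit, \<open>sigma_x\<close> and
  \<open>sigma_y\<close> flip both of its indices; on off-diagonal units \<open>sigma_z\<close> and
  \<open>sigma_y\<close> each bring a minus sign, which gives \<open>c\<close> and \<open>d\<close>
  in place of \<open>a\<close> and \<open>b\<close>.\<close>

lemma pauli_channel_matrix_unit:
  assumes "a = \<pi>\<^sub>0 + \<pi>\<^sub>3" and "b = \<pi>\<^sub>1 + \<pi>\<^sub>2" and "c = \<pi>\<^sub>0 - \<pi>\<^sub>3" and "d = \<pi>\<^sub>1 - \<pi>\<^sub>2"
  shows "pauli_channel \<pi>\<^sub>0 \<pi>\<^sub>1 \<pi>\<^sub>2 \<pi>\<^sub>3 (outer (ket x) (ket y)) $ p $ q =
    (if (p = q) = (x = y) then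
       of_real (if x = y then if p = x then a else b else if p = x then c else d) else 0)"
  using bit_cases[of x] bit_cases[of y] bit_cases[of p] bit_cases[of q]
  unfolding assms pauli_channel_def sigma_x_def sigma_y_def sigma_z_def
  by (elim disjE) (simp_all add: outer_def ket_def axis_def matrix_matrix_mult_def sum_bit complex_eq_iff)

text \<open>With (\<open>a\<close>, \<open>b\<close>) and (\<open>b\<close>, \<open>a\<close>) these
  are the contributions of the two diagonal units of the cat projector to a diagonal entry; with
  (\<open>c\<close>, \<open>d\<close>) and (\<open>d\<close>, \<open>c\<close>), those of its two
  off-diagonal units to an antidiagonal entry.\<close>

definition bit_weight :: "real \<Rightarrow> real \<Rightarrow> ('n::finite \<Rightarrow> 2) \<Rightarrow> real" where
  "bit_weight x y u = (\<Prod>i\<in>UNIV. if u i = 0 then x else y)"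

lemma bit_weight_power:
  "bit_weight x y (u :: 'n::finite \<Rightarrow> 2) = x ^ card {i. u i = 0} * y ^ (CARD('n) - card {i. u i = 0})"
proof -
  have "card (- {i. u i = 0}) = CARD('n) - card {i. u i = 0}"
    by (simp add: Compl_eq_Diff_UNIV card_Diff_subset)
  then show ?thesis
    unfolding bit_weight_def by (subst prod.If_cases) simp_all
qed

lemma bit_weight_flip: "bit_weight x y (\<lambda>i. 1 - u i) = bit_weight y x u"
  unfolding bit_weight_def
proof (intro prod.cong refl)
  show "(if 1 - u i = 0 then x else y) = (if u i = 0 then y else x)" for i
    using bit_cases[of "u i"] by auto
qed

lemma sum_bit_weight: "(\<Sum>u\<in>UNIV. bit_weight x y (u :: 'n::finite \<Rightarrow> 2)) = (x + y) ^ CARD('n)"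
proof -
  \<comment> \<open>The passage to complex numbers matches the type of \<open>prod_sum_UNIV\<close>,
    which expands the product of sums.\<close>
  have "complex_of_real (\<Sum>u\<in>UNIV. bit_weight x y (u :: 'n \<Rightarrow> 2)) =
      (\<Sum>u\<in>UNIV. \<Prod>i\<in>UNIV. (\<lambda>(i :: 'n) (b :: 2). of_real (if b = 0 then x else y)) i (u i))"
    by (simp add: bit_weight_def)
  also have "\<dots> = of_real ((x + y) ^ CARD('n))"
    by (subst prod_sum_UNIV[symmetric]) (simp add: sum_bit)
  finally show ?thesis
    using of_real_eq_iff by blast
qed

lemma bit_weight_mono: "\<bar>x\<bar> \<le> x' \<Longrightarrow> \<bar>y\<bar> \<le> y' \<Longrightarrow> \<bar>bit_weight x y u\<bar> \<le> bit_weight x' y' u"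
  unfolding bit_weight_def abs_prod by (intro prod_mono) auto

text \<open>Applied to the ket index and then to the bra index, this collapses the double sum over
  strings to four terms.\<close>

lemma sum_cat_vec:
  "(\<Sum>s\<in>UNIV. cat_vec $ s * f s) = (f (\<lambda>_. 0) + f (\<lambda>_. 1)) / sqrt 2"
  "(\<Sum>s\<in>UNIV. cnj (cat_vec $ s) * f s) = (f (\<lambda>_. 0) + f (\<lambda>_. 1)) / sqrt 2"
  for f :: "('n::finite \<Rightarrow> 2) \<Rightarrow> complex"
proof -
  have basis: "tensor_vec (\<lambda>_. ket b) $ s = (if s = (\<lambda>_. b) then 1 else 0)" for b and s :: "'n \<Rightarrow> 2"
    by (auto simp: tensor_vec_def ket_def axis_def fun_eq_iff)
  have cat: "cat_vec $ s = of_real (1 / sqrt 2) * ((if s = (\<lambda>_. 0) then 1 else 0) + (if s = (\<lambda>_. 1) then 1 else 0))"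
    for s :: "'n \<Rightarrow> 2"
    unfolding cat_vec_def by (simp add: basis scaleR_conv_of_real[where 'a = complex])
  have cnj: "cnj (cat_vec $ s) = cat_vec $ s" for s :: "'n \<Rightarrow> 2"
    unfolding cat by simp
  show "(\<Sum>s\<in>UNIV. cat_vec $ s * f s) = (f (\<lambda>_. 0) + f (\<lambda>_. 1)) / sqrt 2"
    unfolding cat
    by (simp add: distrib_right sum.distrib if_distrib[of "\<lambda>x. x * _"] mult.assoc add_divide_distrib
        flip: sum_distrib_left sum_divide_distrib cong: if_cong)
  then show "(\<Sum>s\<in>UNIV. cnj (cat_vec $ s) * f s) = (f (\<lambda>_. 0) + f (\<lambda>_. 1)) / sqrt 2"
    by (simp add: cnj)
qed

text \<open>At each site the channel keeps diagonal units diagonal and off-diagonal ones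
  off-diagonal. Hence the units with equal constant strings reach only the entries with
  \<open>v\<close> = \<open>u\<close>, and the other two only those with \<open>v\<close>
  complementary to \<open>u\<close>.\<close>

lemma noisy_cat_state_entry:
  fixes u v :: "'n::finite \<Rightarrow> 2"
  assumes abcd: "a = \<pi>\<^sub>0 + \<pi>\<^sub>3" "b = \<pi>\<^sub>1 + \<pi>\<^sub>2" "c = \<pi>\<^sub>0 - \<pi>\<^sub>3" "d = \<pi>\<^sub>1 - \<pi>\<^sub>2"
  shows "noisy_cat_state \<pi>\<^sub>0 \<pi>\<^sub>1 \<pi>\<^sub>2 \<pi>\<^sub>3 $ u $ v = of_real (
    (if v = u then (bit_weight a b u + bit_weight b a u) / 2 else 0) +
    (if v = (\<lambda>i. 1 - u i) then (bit_weight c d u + bit_weight d c u) / 2 else 0))"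
proof -
  define T where "T = pauli_channel \<pi>\<^sub>0 \<pi>\<^sub>1 \<pi>\<^sub>2 \<pi>\<^sub>3"
  define F where "F x y = (\<Prod>i\<in>(UNIV :: 'n set). T (outer (ket x) (ket y)) $ u i $ v i)" for x y
  have "noisy_cat_state \<pi>\<^sub>0 \<pi>\<^sub>1 \<pi>\<^sub>2 \<pi>\<^sub>3 $ u $ v = (\<Sum>s\<in>UNIV. cat_vec $ s * (\<Sum>t\<in>UNIV. cnj (cat_vec $ t) *
      (\<Prod>i\<in>UNIV. T (outer (ket (s i)) (ket (t i))) $ u i $ v i)))"
    by (simp add: noisy_cat_state_def channel_power_def outer_def[of cat_vec] tensor_op_def T_def
        sum_distrib_left mult.assoc)
  also have "\<dots> = ((F 0 0 + F 1 1) + (F 0 1 + F 1 0)) / 2"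
    unfolding sum_cat_vec F_def by (simp add: field_simps flip: of_real_mult)
  finally have sum: "noisy_cat_state \<pi>\<^sub>0 \<pi>\<^sub>1 \<pi>\<^sub>2 \<pi>\<^sub>3 $ u $ v = ((F 0 0 + F 1 1) + (F 0 1 + F 1 0)) / 2" .
  note unit = pauli_channel_matrix_unit[OF abcd, folded T_def]
  \<comment> \<open>Subtraction is modulo 2, so \<open>1 - p\<close> is the complementary
    bit.\<close>
  have flip: "p \<noteq> q \<longleftrightarrow> q = 1 - p" "p = 1 \<longleftrightarrow> p \<noteq> 0" for p q :: 2
    using bit_cases[of p] bit_cases[of q] by auto
  have diag: "F x x = (if v = u then of_real (if x = 0 then bit_weight a b u else bit_weight b a u) else 0)" for x
  proof (cases "v = u")
    case True
    then show ?thesis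
      using bit_cases[of x]
      by (auto simp: F_def unit bit_weight_def flip(2)[of "u _"] simp flip: of_real_prod intro!: prod.cong)
  next
    case False
    \<comment> \<open>The factor at this one site vanishes and annihilates the product.\<close>
    then obtain i where "u i \<noteq> v i" by (metis ext)
    then show ?thesis
      using False by (auto simp: F_def unit)
  qed
  have anti: "F x y = (if v = (\<lambda>i. 1 - u i) then of_real (if x = 0 then bit_weight c d u else bit_weight d c u) else 0)"
    if "x \<noteq> y" for x y
  proof (cases "v = (\<lambda>i. 1 - u i)")
    case True
    then have "u i \<noteq> v i" for i
      unfolding flip(1) by simp
    with True that show ?thesis
      using bit_cases[of x]
      by (auto simp: F_def unit bit_weight_def flip(2)[of "u _"] simp flip: of_real_prod intro!: prod.cong)
  next
    case False
    then obtain i where "u i = v i" using flip(1) by (metis ext)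
    then show ?thesis
      using False that by (auto simp: F_def unit)
  qed
  show ?thesis
    unfolding sum using diag[of 0] diag[of 1] anti[of 0 1] anti[of 1 0] by (simp add: add_divide_distrib)
qed

section \<open>Positivity and trace of the noisy cat state\<close>

lemma bit_flip_neq: "(\<lambda>i. 1 - u i) \<noteq> u" for u :: "'n::finite \<Rightarrow> 2"
proof
  assume "(\<lambda>i. 1 - u i) = u"
  then have "1 - u i = u i" for i
    by metis
  then show False
    using bit_cases[of "u undefined"] by (metis diff_zero diff_self zero_neq_one)
qed

text \<open>Pairing each string with its complement splits the state into 2 by 2 blocks with
  diagonal entries \<open>L u\<close> and off-diagonal entries \<open>M u\<close>. Each block is
  positive because |M| \<le> L, and the diagonal sums to 1 because \<open>a + b = 1\<close>.\<close>

lemma noisy_cat_state_density: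
  assumes nonneg: "\<pi>\<^sub>0 \<ge> 0" "\<pi>\<^sub>1 \<ge> 0" "\<pi>\<^sub>2 \<ge> 0" "\<pi>\<^sub>3 \<ge> 0"
    and one: "\<pi>\<^sub>0 + \<pi>\<^sub>1 + \<pi>\<^sub>2 + \<pi>\<^sub>3 = 1"
  shows "density_op (noisy_cat_state \<pi>\<^sub>0 \<pi>\<^sub>1 \<pi>\<^sub>2 \<pi>\<^sub>3 :: 'n::finite qubits_op)"
proof -
  define a b c d where abcd: "a = \<pi>\<^sub>0 + \<pi>\<^sub>3" "b = \<pi>\<^sub>1 + \<pi>\<^sub>2" "c = \<pi>\<^sub>0 - \<pi>\<^sub>3" "d = \<pi>\<^sub>1 - \<pi>\<^sub>2"
  define \<rho> where "\<rho> = (noisy_cat_state \<pi>\<^sub>0 \<pi>\<^sub>1 \<pi>\<^sub>2 \<pi>\<^sub>3 :: 'n qubits_op)"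
  define L M where "L u = (bit_weight a b u + bit_weight b a u) / 2"
    and "M u = (bit_weight c d u + bit_weight d c u) / 2" for u :: "'n \<Rightarrow> 2"
  define inv where "inv u = (\<lambda>i. 1 - u i)" for u :: "'n \<Rightarrow> 2"
  have entry: "\<rho> $ u $ v = of_real ((if v = u then L u else 0) + (if v = inv u then M u else 0))" for u v
    unfolding \<rho>_def L_def M_def inv_def by (rule noisy_cat_state_entry[OF abcd])
  have inv_inv: "inv (inv u) = u" for u
    by (simp add: inv_def)
  have L_inv: "L (inv u) = L u" and M_inv: "M (inv u) = M u" for u
    by (simp_all add: L_def M_def inv_def bit_weight_flip add.commute)
  \<comment> \<open>Nonnegativity of the probabilities gives |c| \<le> a and |d| \<le> b.\<close>
  have le: "\<bar>bit_weight c d u\<bar> \<le> bit_weight a b u" "\<bar>bit_weight d c u\<bar> \<le> bit_weight b a u" for u :: "'n \<Rightarrow> 2"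
    using nonneg by (auto intro!: bit_weight_mono simp: abcd)
  have M_le: "\<bar>M u\<bar> \<le> L u" for u
    using le[of u] unfolding L_def M_def abs_le_iff by (simp add: add_divide_distrib)
  have "positive_op \<rho>"
    unfolding positive_op_def
  proof
    fix v :: "'n qubits_vec"
    let ?f = "\<lambda>u. cnj (v $ u) * (L u * v $ u + M u * v $ inv u)"
    let ?g = "\<lambda>u. L u * ((cmod (v $ u))\<^sup>2 + (cmod (v $ inv u))\<^sup>2) + 2 * M u * Re (cnj (v $ u) * v $ inv u)"
    have "(\<rho> *v v) $ u = L u * v $ u + M u * v $ inv u" for u
      unfolding matrix_vector_mult_def
      by (simp add: entry distrib_right sum.distrib if_distrib[of of_real] if_distrib[of "\<lambda>x. x * _"] cong: if_cong)
    then have f: "(\<Sum>u\<in>UNIV. cnj (v $ u) * (\<rho> *v v) $ u) = sum ?f UNIV"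
      by simp
    \<comment> \<open>Averaging over the involution \<open>inv\<close> joins each cross term to its
      conjugate; \<open>?f u + ?f (inv u)\<close> equals the real number
      \<open>?g u\<close>.\<close>
    have "sum ?f UNIV = (\<Sum>u\<in>UNIV. ?f (inv u))"
      by (rule sum.reindex_bij_witness[of _ inv inv]) (simp_all add: inv_inv)
    then have "2 * sum ?f UNIV = (\<Sum>u\<in>UNIV. ?f u + ?f (inv u))"
      by (simp add: sum.distrib)
    also have "\<dots> = (\<Sum>u\<in>UNIV. of_real (?g u))"
      unfolding L_inv M_inv inv_inv cmod_power2
      by (intro sum.cong refl) (simp add: complex_eq_iff power2_eq_square algebra_simps)
    finally have double: "2 * sum ?f UNIV = of_real (sum ?g UNIV)"
      by (simp only: of_real_sum)
    have "sum ?f UNIV = (2 * sum ?f UNIV) / 2"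
      by simp
    also have "\<dots> = of_real (sum ?g UNIV / 2)"
      unfolding double by (simp only: of_real_divide of_real_numeral)
    finally have real: "sum ?f UNIV = of_real (sum ?g UNIV / 2)" .
    have nonneg: "?g u \<ge> 0" for u
    proof -
      have "2 * \<bar>M u * Re (cnj (v $ u) * v $ inv u)\<bar> \<le> 2 * (L u * (cmod (v $ u) * cmod (v $ inv u)))"
        unfolding abs_mult
        using M_le[of u] abs_Re_le_cmod[of "cnj (v $ u) * v $ inv u"]
        by (intro mult_left_mono mult_mono) (auto simp: norm_mult)
      also have "\<dots> = L u * (2 * cmod (v $ u) * cmod (v $ inv u))"
        by simp
      also have "\<dots> \<le> L u * ((cmod (v $ u))\<^sup>2 + (cmod (v $ inv u))\<^sup>2)"
        using M_le[of u] sum_squares_bound by (intro mult_left_mono) auto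
      finally show ?thesis
        by (simp add: abs_le_iff)
    qed
    have "sum ?g UNIV \<ge> 0"
      by (rule sum_nonneg) (rule nonneg)
    then have "sum ?g UNIV / 2 \<ge> 0"
      by (rule divide_nonneg_nonneg) (rule zero_le_numeral)
    then show "(\<Sum>u\<in>UNIV. cnj (v $ u) * (\<rho> *v v) $ u) \<in> \<real>\<^sub>\<ge>\<^sub>0"
      unfolding f real by (simp only: nonneg_Reals_of_real_iff)
  qed
  moreover have "trace \<rho> = 1"
  proof -
    \<comment> \<open>Complementation has no fixed point, so the antidiagonal terms do not enter the
      trace.\<close>
    have "inv u \<noteq> u" for u
      unfolding inv_def by (rule bit_flip_neq)
    then have "u = inv u \<longleftrightarrow> False" for u
      by metis
    then have "trace \<rho> = (\<Sum>u\<in>UNIV. of_real (L u))"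
      unfolding trace_def entry by simp
    also have "\<dots> = of_real (((a + b) ^ CARD('n) + (b + a) ^ CARD('n)) / 2)"
      unfolding of_real_sum[symmetric] L_def by (simp only: sum.distrib sum_bit_weight flip: sum_divide_distrib)
    also have "\<dots> = 1"
      using one by (simp add: abcd algebra_simps)
    finally show ?thesis .
  qed
  ultimately show ?thesis
    unfolding density_op_def \<rho>_def by simp
qed

section \<open>Violation of the separability bound\<close>

theorem proposition1:
  fixes \<pi>\<^sub>0 \<pi>\<^sub>1 \<pi>\<^sub>2 \<pi>\<^sub>3 a b c d \<Delta> :: real
    and N :: nat
    and lam :: "nat \<Rightarrow> nat \<Rightarrow> real"
  assumes "N = CARD('n::finite)" and "N \<ge> 2"
    and "\<pi>\<^sub>0 \<ge> 0" and "\<pi>\<^sub>1 \<ge> 0" and "\<pi>\<^sub>2 \<ge> 0" and "\<pi>\<^sub>3 \<ge> 0"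
    and "\<pi>\<^sub>0 + \<pi>\<^sub>1 + \<pi>\<^sub>2 + \<pi>\<^sub>3 = 1"
    and "a = \<pi>\<^sub>0 + \<pi>\<^sub>3" and "b = \<pi>\<^sub>1 + \<pi>\<^sub>2"
    and "c = \<pi>\<^sub>0 - \<pi>\<^sub>3" and "d = \<pi>\<^sub>1 - \<pi>\<^sub>2"
    and "\<Delta> = \<bar>c ^ N + d ^ N\<bar>"
    and "\<And>k. k \<le> N \<Longrightarrow> 2 * lam k (N - k) = a ^ k * b ^ (N - k) + b ^ k * a ^ (N - k)"
    and "\<exists>k. 1 \<le> k \<and> k \<le> N div 2 \<and> \<Delta> > 2 * lam k (N - k)"
  shows "entangled (noisy_cat_state \<pi>\<^sub>0 \<pi>\<^sub>1 \<pi>\<^sub>2 \<pi>\<^sub>3 :: 'n qubits_op)"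
  unfolding entangled_def
proof
  let ?\<rho> = "noisy_cat_state \<pi>\<^sub>0 \<pi>\<^sub>1 \<pi>\<^sub>2 \<pi>\<^sub>3 :: 'n qubits_op"
  show "density_op ?\<rho>"
    by (rule noisy_cat_state_density) fact+
  note entry = noisy_cat_state_entry[where ?'n = 'n, OF assms(8-11)]
  obtain k where k: "k \<le> N div 2" and \<Delta>: "\<Delta> > 2 * lam k (N - k)"
    using assms(14) by auto
  have "k \<le> N"
    using k by linarith
  then obtain K :: "'n set" where K: "card K = k"
    using obtain_subset_with_card_n[of k "UNIV :: 'n set"] assms(1) by auto
  \<comment> \<open>The pair \<open>s\<close>, \<open>t\<close> indexes the corner entry; exchanging
    their bits outside \<open>K\<close> yields \<open>w\<close>, with exactly \<open>k\<close>
    zeros, and its complement \<open>w'\<close>.\<close>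
  define s w :: "'n \<Rightarrow> 2" where "s = (\<lambda>_. 0)" and "w = (\<lambda>i. if i \<in> K then 0 else 1)"
  define t w' where "t = (\<lambda>i. 1 - s i)" and "w' = (\<lambda>i. 1 - w i)"
  have weight_s: "bit_weight x y s = x ^ N" for x y
    by (simp add: bit_weight_def s_def assms(1))
  have weight_w: "bit_weight x y w = x ^ k * y ^ (N - k)" for x y
    by (simp add: bit_weight_power w_def K assms(1))
  have "?\<rho> $ s $ t = of_real ((c ^ N + d ^ N) / 2)"
    using bit_flip_neq[of s] unfolding entry t_def by (simp add: weight_s)
  then have corner: "cmod (?\<rho> $ s $ t) = \<Delta> / 2"
    using assms(12) by (simp only: norm_of_real) simp
  have diag: "Re (?\<rho> $ u $ u) = (bit_weight a b u + bit_weight b a u) / 2" for u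
    unfolding entry using bit_flip_neq[of u, THEN not_sym] by simp
  have "Re (?\<rho> $ w $ w) = lam k (N - k)"
    unfolding diag weight_w using assms(13)[OF \<open>k \<le> N\<close>] by simp
  moreover have "Re (?\<rho> $ w' $ w') = lam k (N - k)"
    unfolding diag w'_def bit_weight_flip weight_w using assms(13)[OF \<open>k \<le> N\<close>] by simp
  ultimately have violated: "cmod (?\<rho> $ s $ t) > (Re (?\<rho> $ w $ w) + Re (?\<rho> $ w' $ w')) / 2"
    using \<Delta> corner by simp
  show "\<not> fully_separable ?\<rho>"
  proof
    assume "fully_separable ?\<rho>"
    moreover have "(w i = s i \<and> w' i = t i) \<or> (w i = t i \<and> w' i = s i)" for i
      by (simp add: s_def t_def w_def w'_def)
    ultimately have "cmod (?\<rho> $ s $ t) \<le> (Re (?\<rho> $ w $ w) + Re (?\<rho> $ w' $ w')) / 2"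
      by (rule fully_separable_entry_bound)
    then show False
      using violated by linarith
  qed
qed

end
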